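(* A minor-minimal non-splitting graph cannot have a cut vertex.
   Context: Graphs are finite undirected connected multigraphs, possibly with loops and parallel edges. A cut vertex of a connected graph $G$ is a vertex $v$ such that the graph induced by $V(G)-\{v\}$ is disconnected or trivial. Dodgson polynomials: assign a variable $\alpha_e$ to each edge $e$ of $G$. Orient the edges arbitrarily, let $\xi_G$ be the $|E(G)|\times|V(G)|$ incidence matrix with $(\xi_G)_{e,v}=1$ if $v$ is the source of $e$, $-1$ if $v$ is the target of $e$, and $0$ otherwise (the row of a loop is zero), let $\widehat\xi_G$ be $\xi_G$ with one arbitrary column deleted, and let $A$ be the diagonal matrix with entries $\alpha_e$. Put $$M_G=\begin{pmatrix}A&\widehat\xi_G\\-\widehat\xi_G^{\,T}&0\end{pmatrix}.$$ For $I,J,K\subseteq E(G)$ with $|I|=|J|$, the Dodgson polynomial $\Psi^{I,J}_K$ is the determinant of the matrix obtained from $M_G$ by deleting the rows indexed by $I$, deleting the columns indexed by $J$, and setting $\alpha_e=0$ for all $e\in K$; it is well defined up to sign. A $5$-configuration is a set $S\subseteq E(G)$ with $|S|=5$. $D_S$ is the set of (thirty) Dodgson polynomials $\Psi^{I,J}_K$ with $I\cup J\cup K=S$, $K$ disjoint from $I\cup J$, and either $|I|=|J|=2$, $I\cap J=\emptyset$, $|K|=1$, or $|I|=|J|=3$, $|I\cap J|=1$, $K=\emptyset$. The $5$-configuration $S$ splits if at least one $D\in D_S$ is the zero polynomial; otherwise $S$ is non-splitting. A graph splits if all of its $5$-configurations split; it is non-splitting if it has at least one non-splitting $5$-configuration.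 A non-splitting graph $G$ is minor-minimal non-splitting if for every $e\in E(G)$ both the deletion $G\setminus e$ and the contraction $G/e$ split. *)

theory Defs
  imports "HOL-Library.Poly_Mapping" "Jordan_Normal_Form.Determinant"
begin

text \<open>Undirected multigraphs; an edge is a loop iff its set of ends is a singleton.\<close>

record ('v, 'e) multigraph =
  verts :: "'v set"
  edges :: "'e set"
  ends  :: "'e \<Rightarrow> 'v set"

definition finite_multigraph :: "('v, 'e) multigraph \<Rightarrow> bool" where
  "finite_multigraph G \<longleftrightarrow> finite (verts G) \<and> finite (edges G) \<and>
     (\<forall>e\<in>edges G. ends G e \<subseteq> verts G \<and> card (ends G e) \<in> {1, 2})"

definition adjacency :: "('v, 'e) multigraph \<Rightarrow> ('v \<times> 'v) set" where
  "adjacency G = {(u, v). \<exists>e\<in>edges G. ends G e = {u, v}}"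

definition connected_multigraph :: "('v, 'e) multigraph \<Rightarrow> bool" where
  "connected_multigraph G \<longleftrightarrow>
     verts G \<noteq> {} \<and> (\<forall>u\<in>verts G. \<forall>v\<in>verts G. (u, v) \<in> (adjacency G)\<^sup>*)"

definition induced :: "('v, 'e) multigraph \<Rightarrow> 'v set \<Rightarrow> ('v, 'e) multigraph" where
  "induced G W = \<lparr>verts = W, edges = {e \<in> edges G. ends G e \<subseteq> W}, ends = ends G\<rparr>"

text \<open>Trivial means of order at most one; loops at the remaining vertex are irrelevant.\<close>

definition trivial_multigraph :: "('v, 'e) multigraph \<Rightarrow> bool" where
  "trivial_multigraph G \<longleftrightarrow> card (verts G) \<le> 1"

definition cut_vertex :: "('v, 'e) multigraph \<Rightarrow> 'v \<Rightarrow> bool" where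
  "cut_vertex G v \<longleftrightarrow> v \<in> verts G \<and>
     (\<not> connected_multigraph (induced G (verts G - {v})) \<or>
      trivial_multigraph (induced G (verts G - {v})))"

definition delete_edge :: "('v, 'e) multigraph \<Rightarrow> 'e \<Rightarrow> ('v, 'e) multigraph" where
  "delete_edge G e = \<lparr>verts = verts G, edges = edges G - {e}, ends = ends G\<rparr>"

text \<open>Contraction identifies the ends of \<open>e\<close>, using one of them to name the merged vertex.
  Other edges with both ends in \<open>ends G e\<close> become loops; contracting a loop deletes it.\<close>

definition merge_ends :: "('v, 'e) multigraph \<Rightarrow> 'e \<Rightarrow> 'v \<Rightarrow> 'v" where
  "merge_ends G e v = (if v \<in> ends G e then (SOME w. w \<in> ends G e) else v)"

definition contract_edge :: "('v, 'e) multigraph \<Rightarrow> 'e \<Rightarrow> ('v, 'e) multigraph" where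
  "contract_edge G e =
     \<lparr>verts = merge_ends G e ` verts G, edges = edges G - {e},
      ends = (\<lambda>f. merge_ends G e ` ends G f)\<rparr>"

text \<open>The polynomial ring \<open>\<int>[\<alpha>\<^sub>e]\<close>: finitely supported integer-valued functions on monomials,
  a monomial being a finitely supported exponent vector.\<close>

type_synonym 'e mpoly = "('e \<Rightarrow>\<^sub>0 nat) \<Rightarrow>\<^sub>0 int"

definition edge_var :: "'e \<Rightarrow> 'e mpoly" where
  "edge_var e = Poly_Mapping.single (Poly_Mapping.single e 1) 1"

definition orientation :: "('v, 'e) multigraph \<Rightarrow> ('e \<Rightarrow> 'v) \<Rightarrow> ('e \<Rightarrow> 'v) \<Rightarrow> bool" where
  "orientation G src tgt \<longleftrightarrow> (\<forall>e\<in>edges G. ends G e = {src e, tgt e})"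

definition incidence :: "('e \<Rightarrow> 'v) \<Rightarrow> ('e \<Rightarrow> 'v) \<Rightarrow> 'e \<Rightarrow> 'v \<Rightarrow> 'a::ring_1" where
  "incidence src tgt e v =
     (if src e = tgt e then 0
      else if v = src e then 1
      else if v = tgt e then - 1
      else 0)"

text \<open>Entries of the block matrix \<open>M\<^sub>G\<close> with \<open>\<alpha>\<^sub>e = 0\<close> for \<open>e \<in> K\<close>. Rows and columns are
  indexed by edges (\<open>Inl\<close>) and vertices (\<open>Inr\<close>).\<close>

fun graph_matrix ::
  "('e \<Rightarrow> 'v) \<Rightarrow> ('e \<Rightarrow> 'v) \<Rightarrow> 'e set \<Rightarrow> 'e + 'v \<Rightarrow> 'e + 'v \<Rightarrow> 'e mpoly" where
  "graph_matrix src tgt K (Inl e) (Inl f) = (if e = f \<and> e \<notin> K then edge_var e else 0)"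
| "graph_matrix src tgt K (Inl e) (Inr v) = incidence src tgt e v"
| "graph_matrix src tgt K (Inr v) (Inl e) = - incidence src tgt e v"
| "graph_matrix src tgt K (Inr v) (Inr w) = 0"

text \<open>The indices that remain when the edges in \<open>I\<close> and the vertex \<open>r\<close> are removed.\<close>

definition index_set :: "('v, 'e) multigraph \<Rightarrow> 'v \<Rightarrow> 'e set \<Rightarrow> ('e + 'v) set" where
  "index_set G r I = Inl ` (edges G - I) \<union> Inr ` (verts G - {r})"

text \<open>A Dodgson polynomial is determined only up to sign. The following set collects its values
  for all choices involved: the orientation, the vertex \<open>r\<close> whose column of the incidence matrix
  is deleted, and the orders \<open>rs\<close>, \<open>cs\<close> in which rows and columns are listed. These values agree
  up to sign, so one of them is zero iff all of them are.\<close>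

definition dodgson ::
  "('v, 'e) multigraph \<Rightarrow> 'e set \<Rightarrow> 'e set \<Rightarrow> 'e set \<Rightarrow> 'e mpoly set" where
  "dodgson G I J K =
     {det (mat (length rs) (length cs) (\<lambda>(i, j). graph_matrix src tgt K (rs ! i) (cs ! j))) |
        src tgt r rs cs.
        orientation G src tgt \<and> r \<in> verts G \<and>
        distinct rs \<and> set rs = index_set G r I \<and>
        distinct cs \<and> set cs = index_set G r J}"

definition five_configuration :: "('v, 'e) multigraph \<Rightarrow> 'e set \<Rightarrow> bool" where
  "five_configuration G S \<longleftrightarrow> S \<subseteq> edges G \<and> card S = 5"

definition config_dodgsons :: "('v, 'e) multigraph \<Rightarrow> 'e set \<Rightarrow> 'e mpoly set" where
  "config_dodgsons G S =
     \<Union> {dodgson G I J K | I J K.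
        I \<union> J \<union> K = S \<and> K \<inter> (I \<union> J) = {} \<and>
        (card I = 2 \<and> card J = 2 \<and> I \<inter> J = {} \<and> card K = 1 \<or>
         card I = 3 \<and> card J = 3 \<and> card (I \<inter> J) = 1 \<and> K = {})}"

definition config_splits :: "('v, 'e) multigraph \<Rightarrow> 'e set \<Rightarrow> bool" where
  "config_splits G S \<longleftrightarrow> (\<exists>D\<in>config_dodgsons G S. D = 0)"

definition splits :: "('v, 'e) multigraph \<Rightarrow> bool" where
  "splits G \<longleftrightarrow> (\<forall>S. five_configuration G S \<longrightarrow> config_splits G S)"

definition non_splitting :: "('v, 'e) multigraph \<Rightarrow> bool" where
  "non_splitting G \<longleftrightarrow> (\<exists>S. five_configuration G S \<and> \<not> config_splits G S)"

text \<open>If \<open>e\<close> is a bridge, then \<open>delete_edge G e\<close> is disconnected. All its Dodgson polynomials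
  vanish, so it splits.\<close>

definition minor_minimal_non_splitting :: "('v, 'e) multigraph \<Rightarrow> bool" where
  "minor_minimal_non_splitting G \<longleftrightarrow> non_splitting G \<and>
     (\<forall>e\<in>edges G. splits (delete_edge G e) \<and> splits (contract_edge G e))"

end

theory Submission
  imports Defs
begin

text \<open>The coefficient of \<open>\<Prod>e\<in>T. \<alpha>\<^sub>e\<close> in \<open>\<Psi>\<^bsup>I,J\<^esup>\<^sub>K\<close> is nonzero iff, with \<open>E\<close> the edge set of \<open>G\<close>, both
  \<open>E - I - T\<close> and \<open>E - J - T\<close> are spanning trees of \<open>G\<close> and \<open>T\<close> avoids \<open>S = I \<union> J \<union> K\<close>. So \<open>S\<close> is
  non-splitting iff for all admissible \<open>(I, J, K)\<close> some \<open>F \<subseteq> E - S\<close> completes both \<open>S - I\<close> and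
  \<open>S - J\<close> to spanning trees.

  Let \<open>S\<close> be non-splitting and \<open>v\<close> a cut vertex, so that \<open>G\<close> is the union of two subgraphs that share
  only \<open>v\<close>. Each side contains equally many edges of \<open>I\<close> and of \<open>J\<close>, for every admissible triple.
  Exchanging an element of \<open>I\<close> with the element of \<open>K\<close> shows that any two edges of \<open>S\<close> lie on the
  same side. The part of \<open>F\<close> on the other side can then be replaced by a fixed set \<open>F\<^sub>0\<close>, the same for
  all triples. For an edge \<open>e\<close> of that side, \<open>S\<close> remains non-splitting in \<open>G/e\<close> if \<open>e \<in> F\<^sub>0\<close>, and in
  \<open>G \<setminus> e\<close> otherwise, so \<open>G\<close> is not minor-minimal.\<close>

section \<open>Determinants of matrices indexed by labels\<close>

text \<open>Matrices of the library are indexed by positions. Listing labels makes it possible to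
  argue with edges and vertices as row and column indices; the matrices in \<open>dodgson\<close>
  have this form.\<close>

definition indexed_mat :: "'r list \<Rightarrow> 'c list \<Rightarrow> ('r \<Rightarrow> 'c \<Rightarrow> 'a) \<Rightarrow> 'a mat" where
  "indexed_mat rs cs g = mat (length rs) (length cs) (\<lambda>(i, j). g (rs ! i) (cs ! j))"

lemma indexed_mat_carrier:
  "length rs = length cs \<Longrightarrow> indexed_mat rs cs g \<in> carrier_mat (length rs) (length rs)"
  by (simp add: indexed_mat_def)

lemma det_indexed_mat:
  fixes g :: "'r \<Rightarrow> 'c \<Rightarrow> 'a::comm_ring_1"
  assumes "length rs = length cs"
  shows "det (indexed_mat rs cs g) =
    (\<Sum>p | p permutes {0..<length rs}. signof p * (\<Prod>i=0..<length rs. g (rs ! i) (cs ! p i)))"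
proof -
  have "(\<Prod>i=0..<length rs. indexed_mat rs cs g $$ (i, p i))
      = (\<Prod>i=0..<length rs. g (rs ! i) (cs ! p i))" if "p permutes {0..<length rs}" for p
  proof (rule prod.cong)
    fix i assume "i \<in> {0..<length rs}"
    moreover from this have "p i < length rs"
      using permutes_in_image[OF that, of i] by simp
    ultimately show "indexed_mat rs cs g $$ (i, p i) = g (rs ! i) (cs ! p i)"
      using assms by (simp add: indexed_mat_def)
  qed simp
  then show ?thesis
    by (subst det_def'[OF indexed_mat_carrier[OF assms]]) simp
qed

text \<open>Some term of the Leibniz expansion is nonzero, and a product with a zero factor
  vanishes.\<close>

lemma det_indexed_mat_nonzero_transversal:
  fixes g :: "'r \<Rightarrow> 'c \<Rightarrow> 'a::comm_ring_1"
  assumes "length rs = length cs" "det (indexed_mat rs cs g) \<noteq> 0"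
  obtains p where "p permutes {0..<length rs}" "\<And>i. i < length rs \<Longrightarrow> g (rs ! i) (cs ! p i) \<noteq> 0"
proof -
  from assms have "(\<Sum>p | p permutes {0..<length rs}.
      signof p * (\<Prod>i=0..<length rs. g (rs ! i) (cs ! p i))) \<noteq> 0"
    by (simp add: det_indexed_mat)
  then obtain p where p: "p permutes {0..<length rs}"
    and *: "signof p * (\<Prod>i=0..<length rs. g (rs ! i) (cs ! p i)) \<noteq> 0"
    by (metis (mono_tags, lifting) mem_Collect_eq sum.not_neutral_contains_not_neutral)
  from * have "(\<Prod>i=0..<length rs. g (rs ! i) (cs ! p i)) \<noteq> 0" by auto
  then have "g (rs ! i) (cs ! p i) \<noteq> 0" if "i < length rs" for i
    using prod_zero[of "{0..<length rs}" "\<lambda>i. g (rs ! i) (cs ! p i)"] that by force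
  with p show ?thesis by (rule that)
qed

text \<open>The easy half of the Frobenius-Koenig theorem.\<close>

lemma card_rows_le_card_columns:
  fixes g :: "'r \<Rightarrow> 'c \<Rightarrow> 'a::comm_ring_1"
  assumes "distinct rs" "distinct cs" "length rs = length cs" "det (indexed_mat rs cs g) \<noteq> 0"
    and "R \<subseteq> set rs" "finite C"
    and zero: "\<And>a c. a \<in> R \<Longrightarrow> c \<in> set cs \<Longrightarrow> c \<notin> C \<Longrightarrow> g a c = 0"
  shows "card R \<le> card C"
proof -
  obtain p where p: "p permutes {0..<length rs}"
    and nz: "\<And>i. i < length rs \<Longrightarrow> g (rs ! i) (cs ! p i) \<noteq> 0"
    using det_indexed_mat_nonzero_transversal assms(3,4) by metis
  define N where "N = {i. i < length rs \<and> rs ! i \<in> R}"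
  have p_less: "p i < length cs" if "i \<in> N" for i
    using that permutes_in_image[OF p, of i] assms(3) by (simp add: N_def)
  \<comment> \<open>\<open>N\<close> collects the positions of the rows in \<open>R\<close>. The
    transversal assigns distinct columns to them, and a nonzero entry in such a row forces its
    column into \<open>C\<close>.\<close>
  have "inj_on (\<lambda>i. cs ! p i) N"
  proof (rule inj_onI)
    fix i j assume "i \<in> N" "j \<in> N" "cs ! p i = cs ! p j"
    then have "p i = p j" using p_less assms(2) by (simp add: nth_eq_iff_index_eq)
    then show "i = j" using permutes_inj[OF p] by (simp add: inj_eq)
  qed
  moreover have "(\<lambda>i. cs ! p i) ` N \<subseteq> C"
  proof (rule image_subsetI)
    fix i assume "i \<in> N"
    then show "cs ! p i \<in> C"
      using zero[of "rs ! i" "cs ! p i"] nz[of i] p_less[of i] by (auto simp: N_def)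
  qed
  ultimately have "card N \<le> card C" using card_inj_on_le \<open>finite C\<close> by blast
  moreover have "R \<subseteq> (!) rs ` N"
  proof
    fix a assume "a \<in> R"
    moreover from this obtain i where "i < length rs" "a = rs ! i"
      using assms(5) by (metis in_set_conv_nth subsetD)
    ultimately show "a \<in> (!) rs ` N" by (auto simp: N_def)
  qed
  then have "card R \<le> card N" by (rule surj_card_le[rotated]) (simp add: N_def)
  ultimately show ?thesis by simp
qed

lemma sum_nth_distinct:
  "distinct cs \<Longrightarrow> (\<Sum>j=0..<length cs. h (cs ! j)) = (\<Sum>c\<in>set cs. h c)"
  by (metis atLeast0LessThan bij_betw_nth sum.reindex_bij_betw)

text \<open>Turns a vector over positions into a function of labels, which is well defined because
  the labels are distinct.\<close>

lemma index_function:
  assumes "distinct cs" "dim_vec v = length cs"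
  obtains X where "\<And>j. j < length cs \<Longrightarrow> X (cs ! j) = v $ j"
proof -
  define X where "X c = v $ (THE j. j < length cs \<and> cs ! j = c)" for c
  have "(THE j'. j' < length cs \<and> cs ! j' = cs ! j) = j" if "j < length cs" for j
    using that assms(1) by (intro the_equality) (auto simp: nth_eq_iff_index_eq)
  then have "X (cs ! j) = v $ j" if "j < length cs" for j
    using that by (simp add: X_def)
  then show ?thesis by (rule that)
qed

text \<open>Over an integral domain a singular square matrix kills a nonzero vector. This is the
  form used to prove that a determinant does not vanish.\<close>

lemma det_indexed_mat_nonzeroI:
  fixes g :: "'r \<Rightarrow> 'c \<Rightarrow> 'a::idom"
  assumes "distinct cs" "length rs = length cs"
    and ker: "\<And>X. (\<And>a. a \<in> set rs \<Longrightarrow> (\<Sum>c\<in>set cs. g a c * X c) = 0) \<Longrightarrow>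
      (\<And>c. c \<in> set cs \<Longrightarrow> X c = 0)"
  shows "det (indexed_mat rs cs g) \<noteq> 0"
proof
  assume "det (indexed_mat rs cs g) = 0"
  then obtain v where v: "v \<in> carrier_vec (length rs)" "v \<noteq> 0\<^sub>v (length rs)"
    and 0: "indexed_mat rs cs g *\<^sub>v v = 0\<^sub>v (length rs)"
    using det_0_iff_vec_prod_zero[OF indexed_mat_carrier[OF assms(2)]] by blast
  obtain X where X: "\<And>j. j < length cs \<Longrightarrow> X (cs ! j) = v $ j"
    using index_function[OF assms(1)] v(1) assms(2) by (metis carrier_vecD)
  have "(\<Sum>c\<in>set cs. g a c * X c) = 0" if a: "a \<in> set rs" for a
  proof -
    obtain i where i: "i < length rs" "a = rs ! i" using a by (metis in_set_conv_nth)
    have "(\<Sum>c\<in>set cs. g a c * X c) = (\<Sum>j=0..<length cs. g a (cs ! j) * X (cs ! j))"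
      by (rule sum_nth_distinct[symmetric, OF assms(1)])
    also have "\<dots> = (indexed_mat rs cs g *\<^sub>v v) $ i"
      using i v(1) assms(2) X by (auto simp: indexed_mat_def scalar_prod_def intro!: sum.cong)
    finally show ?thesis using 0 i by simp
  qed
  then have "X c = 0" if "c \<in> set cs" for c using ker that by blast
  then have "v $ j = 0" if "j < length rs" for j
    using that X[of j] assms(2) by simp
  then have "v = 0\<^sub>v (length rs)"
    using v(1) by (intro eq_vecI) auto
  with v(2) show False by simp
qed

lemma det_indexed_mat_nonzero_kernel:
  fixes g :: "'r \<Rightarrow> 'c \<Rightarrow> 'a::idom"
  assumes "distinct cs" "length rs = length cs" "det (indexed_mat rs cs g) \<noteq> 0"
    and X: "\<And>a. a \<in> set rs \<Longrightarrow> (\<Sum>c\<in>set cs. g a c * X c) = 0" and c: "c \<in> set cs"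
  shows "X c = 0"
proof -
  define v where "v = vec (length rs) (\<lambda>j. X (cs ! j))"
  have "indexed_mat rs cs g *\<^sub>v v = 0\<^sub>v (length rs)"
  proof (rule eq_vecI)
    fix i assume "i < dim_vec (0\<^sub>v (length rs))"
    then have i: "i < length rs" by simp
    then have "(indexed_mat rs cs g *\<^sub>v v) $ i = (\<Sum>j=0..<length cs. g (rs ! i) (cs ! j) * X (cs ! j))"
      using assms(2) by (auto simp: indexed_mat_def v_def scalar_prod_def intro!: sum.cong)
    also have "\<dots> = (\<Sum>c\<in>set cs. g (rs ! i) c * X c)"
      by (rule sum_nth_distinct[OF assms(1)])
    also have "\<dots> = 0" using X[of "rs ! i"] i by simp
    finally show "(indexed_mat rs cs g *\<^sub>v v) $ i = 0\<^sub>v (length rs) $ i" using i by simp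
  qed (simp add: indexed_mat_def)
  then have "v = 0\<^sub>v (length rs)"
    using det_0_iff_vec_prod_zero[OF indexed_mat_carrier[OF assms(2)], of g] assms(3)
    by (metis v_def vec_carrier)
  moreover obtain j where "j < length rs" "c = cs ! j"
    using c assms(2) by (metis in_set_conv_nth)
  ultimately show ?thesis by (metis index_vec index_zero_vec(1) v_def)
qed

text \<open>\<open>Z\<close> is a row of the adjugate. The coefficients form only a ring, so the
  determinant takes the place of the 1 that a row of the inverse would give.\<close>

lemma det_indexed_mat_nonzero_left_solution:
  fixes g :: "'r \<Rightarrow> 'c \<Rightarrow> 'a::comm_ring_1"
  assumes "distinct rs" "distinct cs" "length rs = length cs" "c0 \<in> set cs"
  obtains Z where "\<And>c. c \<in> set cs \<Longrightarrow>
    (\<Sum>a\<in>set rs. Z a * g a c) = (if c = c0 then det (indexed_mat rs cs g) else 0)"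
proof -
  let ?M = "indexed_mat rs cs g" let ?n = "length rs"
  note car = indexed_mat_carrier[OF assms(3), of g]
  obtain k where k: "k < ?n" "c0 = cs ! k" using assms(3,4) by (metis in_set_conv_nth)
  obtain Z where Z: "\<And>i. i < ?n \<Longrightarrow> Z (rs ! i) = row (adj_mat ?M) k $ i"
    using index_function[OF assms(1), of "row (adj_mat ?M) k"] adj_mat(1)[OF car] by auto
  show ?thesis
  proof (rule that)
    fix c assume "c \<in> set cs"
    then obtain j where j: "j < ?n" "c = cs ! j" using assms(3) by (metis in_set_conv_nth)
    have "(\<Sum>a\<in>set rs. Z a * g a c) = (\<Sum>i=0..<?n. Z (rs ! i) * g (rs ! i) c)"
      by (rule sum_nth_distinct[symmetric, OF assms(1)])
    also have "\<dots> = (adj_mat ?M * ?M) $$ (k, j)"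
      using j k assms(3) Z adj_mat(1)[OF car] car
      by (auto simp: indexed_mat_def scalar_prod_def intro!: sum.cong)
    also have "\<dots> = (if c = c0 then det ?M else 0)"
      using j k assms(2,3) by (simp add: adj_mat(3)[OF car] nth_eq_iff_index_eq)
    finally show "(\<Sum>a\<in>set rs. Z a * g a c) = (if c = c0 then det ?M else 0)" .
  qed
qed

section \<open>Coefficients of Dodgson polynomials\<close>

definition edge_set_monomial :: "'e set \<Rightarrow> 'e \<Rightarrow>\<^sub>0 nat" where
  "edge_set_monomial T = (\<Sum>e\<in>T. Poly_Mapping.single e 1)"

lemma lookup_edge_set_monomial:
  "finite T \<Longrightarrow> Poly_Mapping.lookup (edge_set_monomial T) e = of_bool (e \<in> T)"
  by (simp add: edge_set_monomial_def lookup_sum lookup_single when_def)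

text \<open>Its determinant is the coefficient of \<open>\<Prod>e\<in>T. \<alpha>\<^sub>e\<close> in the Dodgson polynomial: in the Leibniz
  expansion exactly the rows in \<open>T\<close> use their diagonal entry.\<close>

fun coefficient_matrix ::
  "('e \<Rightarrow> 'v) \<Rightarrow> ('e \<Rightarrow> 'v) \<Rightarrow> 'e set \<Rightarrow> 'e + 'v \<Rightarrow> 'e + 'v \<Rightarrow> int" where
  "coefficient_matrix src tgt T (Inl e) (Inl f) = of_bool (e = f \<and> e \<in> T)"
| "coefficient_matrix src tgt T (Inl e) (Inr v) = (if e \<in> T then 0 else incidence src tgt e v)"
| "coefficient_matrix src tgt T (Inr v) (Inl e) = - incidence src tgt e v"
| "coefficient_matrix src tgt T (Inr v) (Inr w) = 0"

text \<open>Every entry of the graph matrix is an integer times one monomial; this is the exponent,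
  and \<open>entry_coefficient\<close> the integer. On a diagonal entry with edge in
  \<open>K\<close> the exponent is harmless because the integer is 0.\<close>

fun entry_exponent :: "'e + 'v \<Rightarrow> 'e + 'v \<Rightarrow> 'e \<Rightarrow>\<^sub>0 nat" where
  "entry_exponent (Inl e) (Inl f) = (if e = f then Poly_Mapping.single e 1 else 0)"
| "entry_exponent _ _ = 0"

fun entry_coefficient ::
  "('e \<Rightarrow> 'v) \<Rightarrow> ('e \<Rightarrow> 'v) \<Rightarrow> 'e set \<Rightarrow> 'e + 'v \<Rightarrow> 'e + 'v \<Rightarrow> int" where
  "entry_coefficient src tgt K (Inl e) (Inl f) = of_bool (e = f \<and> e \<notin> K)"
| "entry_coefficient src tgt K (Inl e) (Inr v) = incidence src tgt e v"
| "entry_coefficient src tgt K (Inr v) (Inl e) = - incidence src tgt e v"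
| "entry_coefficient src tgt K (Inr v) (Inr w) = 0"

lemma graph_matrix_eq_single:
  "graph_matrix src tgt K a c =
    Poly_Mapping.single (entry_exponent a c) (entry_coefficient src tgt K a c)"
proof -
  have "incidence src tgt e v = Poly_Mapping.single 0 (incidence src tgt e v)"
    for e :: 'a and v :: 'b
    by (simp add: incidence_def single_uminus)
  then show ?thesis
    by (cases a; cases c) (auto simp: edge_var_def single_uminus)
qed

lemma prod_single:
  fixes c :: "'i \<Rightarrow> 'a::comm_semiring_1" and m :: "'i \<Rightarrow> 'b::comm_monoid_add"
  assumes "finite A"
  shows "(\<Prod>i\<in>A. Poly_Mapping.single (m i) (c i)) = Poly_Mapping.single (\<Sum>i\<in>A. m i) (\<Prod>i\<in>A. c i)"
  using assms by (induction rule: finite_induct) (auto simp: mult_single)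

lemma lookup_sum_entry_exponent:
  fixes x y :: "'i \<Rightarrow> 'e + 'v"
  shows "Poly_Mapping.lookup (\<Sum>i\<in>A. entry_exponent (x i) (y i)) e =
    (\<Sum>i\<in>A. of_bool (x i = Inl e \<and> y i = Inl e))"
proof -
  have "Poly_Mapping.lookup (entry_exponent a c) e = of_bool (a = Inl e \<and> c = Inl e)" for a c :: "'e + 'v"
    by (cases a; cases c) (auto simp: lookup_single when_def)
  then show ?thesis by (simp add: lookup_sum)
qed

text \<open>The variable of \<open>e\<close> occurs only in the row of \<open>e\<close>, which is
  listed at most once. Hence all monomials in the Leibniz expansion are squarefree.\<close>

lemma lookup_sum_entry_exponent_distinct:
  assumes "distinct rs"
  shows "Poly_Mapping.lookup (\<Sum>i=0..<length rs. entry_exponent (rs ! i) (y i)) e =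
    of_bool (\<exists>i<length rs. rs ! i = Inl e \<and> y i = Inl e)"
proof (cases "\<exists>i<length rs. rs ! i = Inl e \<and> y i = Inl e")
  case True
  then obtain i where i: "i < length rs" "rs ! i = Inl e" "y i = Inl e" by blast
  then have "(\<Sum>j=0..<length rs. of_bool (rs ! j = Inl e \<and> y j = Inl e)) =
      (\<Sum>j=0..<length rs. if j = i then 1 else (0::nat))"
    using nth_eq_iff_index_eq[OF assms, of _ i] by (intro sum.cong) auto
  with i True show ?thesis by (simp add: lookup_sum_entry_exponent)
next
  case False
  then show ?thesis by (auto simp: lookup_sum_entry_exponent)
qed

lemma coefficient_matrix_row_in:
  "e \<in> T \<Longrightarrow> coefficient_matrix src tgt T (Inl e) c = of_bool (c = Inl e)"
  by (cases c) auto

text \<open>Compares a single Leibniz term: its monomial is that of \<open>T\<close> iff the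
  diagonal entries it uses are exactly those of the edges in \<open>T\<close>. Since
  \<open>T\<close> avoids \<open>K\<close>, these diagonal entries have coefficient 1.\<close>

lemma lookup_prod_graph_matrix:
  assumes "distinct rs" "Inl ` T \<subseteq> set rs" "T \<inter> K = {}" "finite T"
  shows "Poly_Mapping.lookup (\<Prod>i=0..<length rs. graph_matrix src tgt K (rs ! i) (y i))
      (edge_set_monomial T) = (\<Prod>i=0..<length rs. coefficient_matrix src tgt T (rs ! i) (y i))"
proof -
  let ?m = "\<Sum>i=0..<length rs. entry_exponent (rs ! i) (y i)"
  note m = lookup_sum_entry_exponent_distinct[OF assms(1), of y]
  note T = lookup_edge_set_monomial[OF assms(4)]
  have lhs: "Poly_Mapping.lookup (\<Prod>i=0..<length rs. graph_matrix src tgt K (rs ! i) (y i))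
      (edge_set_monomial T) =
      ((\<Prod>i=0..<length rs. entry_coefficient src tgt K (rs ! i) (y i)) when ?m = edge_set_monomial T)"
    by (simp add: graph_matrix_eq_single prod_single lookup_single)
  show ?thesis
  proof (cases "?m = edge_set_monomial T")
    case True
    have diag: "e \<in> T \<longleftrightarrow> (\<exists>i<length rs. rs ! i = Inl e \<and> y i = Inl e)" for e
      using m[of e] T[of e] unfolding True of_bool_eq_iff[symmetric, where 'a = nat] by simp
    have "entry_coefficient src tgt K (rs ! i) (y i) = coefficient_matrix src tgt T (rs ! i) (y i)"
      if i: "i < length rs" for i
    proof (cases "rs ! i")
      case (Inl e)
      show ?thesis
      proof (cases "e \<in> T")
        case True
        then obtain j where "j < length rs" "rs ! j = Inl e" "y j = Inl e" using diag by blast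
        then have "y i = Inl e" using Inl i nth_eq_iff_index_eq[OF assms(1)] by metis
        then show ?thesis using Inl True assms(3) by auto
      next
        case False
        then have "y i \<noteq> Inl e" using diag i Inl by blast
        then show ?thesis using Inl False by (cases "y i") auto
      qed
    next
      case (Inr v)
      then show ?thesis by (cases "y i") auto
    qed
    then have "(\<Prod>i=0..<length rs. entry_coefficient src tgt K (rs ! i) (y i)) =
        (\<Prod>i=0..<length rs. coefficient_matrix src tgt T (rs ! i) (y i))"
      by (intro prod.cong) auto
    then show ?thesis unfolding lhs True when_def by simp
  next
    case False
    \<comment> \<open>At this \<open>e\<close> the term either leaves the diagonal in a row of
      \<open>T\<close> or uses the diagonal entry of an edge outside \<open>T\<close>. Both entries
      are 0 in \<open>coefficient_matrix\<close>.\<close>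
    then obtain e where e: "Poly_Mapping.lookup ?m e \<noteq> of_bool (e \<in> T)"
      using T by (metis poly_mapping_eqI)
    have "\<exists>i<length rs. coefficient_matrix src tgt T (rs ! i) (y i) = 0"
    proof (cases "e \<in> T")
      case True
      then obtain i where "i < length rs" "rs ! i = Inl e"
        using assms(2) by (metis image_subset_iff in_set_conv_nth)
      moreover have "y i \<noteq> Inl e"
      proof
        assume "y i = Inl e"
        with calculation have "\<exists>i<length rs. rs ! i = Inl e \<and> y i = Inl e" by blast
        with e True show False unfolding m by simp
      qed
      ultimately show ?thesis using True by (auto simp: coefficient_matrix_row_in)
    next
      case False
      with e have "\<exists>i<length rs. rs ! i = Inl e \<and> y i = Inl e" 
        unfolding m of_bool_eq_iff by blast
      then show ?thesis using False by force
    qed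
    then have "(\<Prod>i=0..<length rs. coefficient_matrix src tgt T (rs ! i) (y i)) = 0"
      by (intro prod_zero) auto
    then show ?thesis unfolding lhs when_def if_not_P[OF False] by simp
  qed
qed

lemma lookup_signof_mult:
  fixes q :: "'e mpoly"
  shows "Poly_Mapping.lookup (signof p * q) m = signof p * Poly_Mapping.lookup q m"
  by (cases p rule: sign_cases) simp_all

lemma lookup_det_graph_matrix:
  assumes "distinct rs" "length rs = length cs" "Inl ` T \<subseteq> set rs" "T \<inter> K = {}" "finite T"
  shows "Poly_Mapping.lookup (det (indexed_mat rs cs (graph_matrix src tgt K))) (edge_set_monomial T)
    = det (indexed_mat rs cs (coefficient_matrix src tgt T))"
  by (simp add: det_indexed_mat[OF assms(2)] lookup_sum lookup_signof_mult
      lookup_prod_graph_matrix[OF assms(1,3,4,5)])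

lemma det_graph_matrix_nonzero_iff:
  assumes "distinct rs" "length rs = length cs"
  shows "det (indexed_mat rs cs (graph_matrix src tgt K)) \<noteq> 0 \<longleftrightarrow>
    (\<exists>T. finite T \<and> Inl ` T \<subseteq> set rs \<and> T \<inter> K = {} \<and>
      det (indexed_mat rs cs (coefficient_matrix src tgt T)) \<noteq> 0)"
    (is "?D \<noteq> 0 \<longleftrightarrow> _")
proof
  assume "?D \<noteq> 0"
  then obtain m where m: "Poly_Mapping.lookup ?D m \<noteq> 0" by (metis lookup_zero poly_mapping_eqI)
  then have "(\<Sum>p | p permutes {0..<length rs}. signof p *
      Poly_Mapping.lookup (\<Prod>i=0..<length rs. graph_matrix src tgt K (rs ! i) (cs ! p i)) m) \<noteq> 0"
    by (simp add: det_indexed_mat[OF assms(2)] lookup_sum lookup_signof_mult)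
  then obtain p where
    "Poly_Mapping.lookup (\<Prod>i=0..<length rs. graph_matrix src tgt K (rs ! i) (cs ! p i)) m \<noteq> 0"
    by (metis (no_types, lifting) mult_zero_right sum.neutral)
  then have meq: "m = (\<Sum>i=0..<length rs. entry_exponent (rs ! i) (cs ! p i))"
    and "(\<Prod>i=0..<length rs. entry_coefficient src tgt K (rs ! i) (cs ! p i)) \<noteq> 0"
    by (auto simp: graph_matrix_eq_single prod_single lookup_single when_def split: if_splits)
  then have nz: "entry_coefficient src tgt K (rs ! i) (cs ! p i) \<noteq> 0" if "i < length rs" for i
    using that by (auto simp: prod_zero_iff)
  \<comment> \<open>The monomial \<open>m\<close> comes from one permutation, and \<open>T\<close>
    is the set of edges whose diagonal entry that permutation uses. These entries are nonzero, so
    \<open>T\<close> avoids \<open>K\<close>.\<close>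
  define T where "T = {e. \<exists>i<length rs. rs ! i = Inl e \<and> cs ! p i = Inl e}"
  have rows: "Inl ` T \<subseteq> set rs" by (auto simp: T_def in_set_conv_nth)
  then have fin: "finite T" by (meson List.finite_set finite_imageD finite_subset inj_Inl inj_on_subset subset_UNIV)
  have "T \<inter> K = {}" using nz by (fastforce simp: T_def)
  moreover have "m = edge_set_monomial T"
    unfolding meq
    by (rule poly_mapping_eqI)
      (simp add: lookup_sum_entry_exponent_distinct[OF assms(1)] lookup_edge_set_monomial[OF fin],
        simp add: T_def)
  ultimately show "\<exists>T. finite T \<and> Inl ` T \<subseteq> set rs \<and> T \<inter> K = {} \<and>
      det (indexed_mat rs cs (coefficient_matrix src tgt T)) \<noteq> 0"
    using m fin rows lookup_det_graph_matrix[OF assms] by metis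
next
  assume "\<exists>T. finite T \<and> Inl ` T \<subseteq> set rs \<and> T \<inter> K = {} \<and>
      det (indexed_mat rs cs (coefficient_matrix src tgt T)) \<noteq> 0"
  then show "?D \<noteq> 0" using lookup_det_graph_matrix[OF assms] by (metis lookup_zero)
qed

section \<open>Nonzero coefficients, spanning sets and forests\<close>

text \<open>Potentials encode the combinatorics of forests without paths or cycles: \<open>P\<close> spans iff only
  constant potentials are constant along \<open>P\<close>, and \<open>P\<close> is a forest iff each of its edges is a bridge,
  that is, carries a nonzero difference of some potential that is constant along the other edges.\<close>

definition constant_along :: "('v, 'e) multigraph \<Rightarrow> 'e set \<Rightarrow> ('v \<Rightarrow> int) \<Rightarrow> bool" where
  "constant_along G P f \<longleftrightarrow> (\<forall>e\<in>P. \<forall>u\<in>ends G e. \<forall>w\<in>ends G e. f u = f w)"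

definition spanning :: "('v, 'e) multigraph \<Rightarrow> 'e set \<Rightarrow> bool" where
  "spanning G P \<longleftrightarrow> (\<forall>f. constant_along G P f \<longrightarrow> (\<forall>u\<in>verts G. \<forall>w\<in>verts G. f u = f w))"

definition forest :: "('v, 'e) multigraph \<Rightarrow> 'e set \<Rightarrow> bool" where
  "forest G P \<longleftrightarrow> (\<forall>e\<in>P. \<exists>f. constant_along G (P - {e}) f \<and> \<not> constant_along G {e} f)"

lemma constant_along_orientation:
  assumes "orientation G src tgt" "P \<subseteq> edges G"
  shows "constant_along G P f \<longleftrightarrow> (\<forall>e\<in>P. f (src e) = f (tgt e))"
proof -
  have "ends G e = {src e, tgt e}" if "e \<in> P" for e
    using assms that by (auto simp: orientation_def)
  then show ?thesis unfolding constant_along_def by (intro ball_cong) auto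
qed

text \<open>An incidence row applied to a potential gives the difference across the edge. Here
  \<open>W\<close> will lack the deleted vertex, so the potential has to vanish there to make up for
  the missing column.\<close>

lemma sum_incidence:
  fixes f :: "'v \<Rightarrow> int"
  assumes "finite W" "src e \<notin> W \<Longrightarrow> f (src e) = 0" "tgt e \<notin> W \<Longrightarrow> f (tgt e) = 0"
  shows "(\<Sum>v\<in>W. incidence src tgt e v * f v) = f (src e) - f (tgt e)"
proof (cases "src e = tgt e")
  case True
  then show ?thesis by (simp add: incidence_def)
next
  case False
  then have "(\<Sum>v\<in>W. incidence src tgt e v * f v) =
      (\<Sum>v\<in>W. (if v = src e then f v else 0) - (if v = tgt e then f v else 0))"
    by (intro sum.cong) (auto simp: incidence_def)
  also have "\<dots> = f (src e) - f (tgt e)"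
    using assms by (auto simp: sum_subtractf)
  finally show ?thesis .
qed

lemma sum_index_set:
  assumes "finite (verts G)" "finite (edges G)"
  shows "(\<Sum>a\<in>index_set G r I. h a) =
    (\<Sum>e\<in>edges G - I. h (Inl e)) + (\<Sum>v\<in>verts G - {r}. h (Inr v))"
proof -
  have "(\<Sum>a\<in>index_set G r I. h a) =
      sum h (Inl ` (edges G - I)) + sum h (Inr ` (verts G - {r}))"
    unfolding index_set_def using assms by (intro sum.union_disjoint) auto
  then show ?thesis by (simp add: sum.reindex)
qed

text \<open>A potential constant along \<open>E - I - T\<close>, where \<open>E\<close> is the edge
  set, yields a kernel vector and is therefore constant. For the forest, a left solution for the
  column of an edge yields a potential whose only nonzero difference along \<open>E - J - T\<close>
  is across that edge.\<close>

lemma det_coefficient_matrix_nonzeroD: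
  fixes G :: "('v, 'e) multigraph"
  assumes fin: "finite (verts G)" "finite (edges G)"
    and wf: "\<And>e. e \<in> edges G \<Longrightarrow> ends G e \<subseteq> verts G"
    and orient: "orientation G src tgt"
    and rs: "distinct rs" "set rs = index_set G r I"
    and cs: "distinct cs" "set cs = index_set G r J"
    and len: "length rs = length cs"
    and r: "r \<in> verts G"
    and det: "det (indexed_mat rs cs (coefficient_matrix src tgt T)) \<noteq> 0"
  shows "spanning G (edges G - I - T)" "forest G (edges G - J - T)"
proof -
  let ?N = "coefficient_matrix src tgt T" and ?V = "verts G - {r}"
  have in_verts: "src e \<in> verts G" "tgt e \<in> verts G" if "e \<in> edges G" for e
    using orient wf[OF that] that by (auto simp: orientation_def)
  note along = constant_along_orientation[OF orient]
  show "spanning G (edges G - I - T)"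
    unfolding spanning_def
  proof (intro allI impI)
    fix f :: "'v \<Rightarrow> int"
    assume f: "constant_along G (edges G - I - T) f"
    \<comment> \<open>Subtracting \<open>f r\<close> makes the potential vanish at the deleted
      vertex; the edge coordinates are 0, so the vertex rows vanish trivially.\<close>
    define X :: "'e + 'v \<Rightarrow> int" where "X = case_sum (\<lambda>e. 0) (\<lambda>v. f v - f r)"
    have "(\<Sum>c\<in>set cs. ?N a c * X c) = 0" if a: "a \<in> set rs" for a
    proof (cases a)
      case (Inl e)
      then have e: "e \<in> edges G - I" using a rs(2) by (auto simp: index_set_def)
      have "(\<Sum>v\<in>?V. incidence src tgt e v * (f v - f r)) = f (src e) - f (tgt e)"
        using e fin in_verts by (subst sum_incidence) auto
      moreover have "f (src e) = f (tgt e)" if "e \<notin> T"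
        using that e f along[of "edges G - I - T" f] by blast
      ultimately show ?thesis
        using Inl fin by (cases "e \<in> T") (simp_all add: cs(2) sum_index_set X_def)
    next
      case (Inr v)
      then show ?thesis using fin by (simp add: cs(2) sum_index_set X_def)
    qed
    then have "X c = 0" if "c \<in> set cs" for c
      using det_indexed_mat_nonzero_kernel[OF cs(1) len det, of X] that by blast
    then have "X (Inr v) = 0" if "v \<in> ?V" for v
      using that by (simp add: cs(2) index_set_def)
    then have "f v = f r" if "v \<in> verts G" for v
      using that by (cases "v = r") (auto simp: X_def)
    then show "\<forall>u\<in>verts G. \<forall>w\<in>verts G. f u = f w" by simp
  qed
  show "forest G (edges G - J - T)"
    unfolding forest_def
  proof
    fix e0 assume e0: "e0 \<in> edges G - J - T"
    then have "Inl e0 \<in> set cs" by (auto simp: cs(2) index_set_def)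
    then obtain Z where Z: "\<And>c. c \<in> set cs \<Longrightarrow> (\<Sum>a\<in>set rs. Z a * ?N a c) =
        (if c = Inl e0 then det (indexed_mat rs cs ?N) else 0)"
      using det_indexed_mat_nonzero_left_solution[OF rs(1) cs(1) len, of "Inl e0" ?N] by blast
    \<comment> \<open>The vertex part of the left solution is read as a potential with value 0 at
      \<open>r\<close>. The edge rows do not contribute to the columns considered, since those edges
      lie outside \<open>T\<close>.\<close>
    define f where "f v = (if v \<in> ?V then Z (Inr v) else 0)" for v
    have diff: "f (tgt e) - f (src e) = (if e = e0 then det (indexed_mat rs cs ?N) else 0)"
      if e: "e \<in> edges G - J - T" for e
    proof -
      have "(if e = e0 then det (indexed_mat rs cs ?N) else 0) = (\<Sum>a\<in>set rs. Z a * ?N a (Inl e))"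
        using Z[of "Inl e"] e by (auto simp: cs(2) index_set_def)
      also have "\<dots> = (\<Sum>v\<in>?V. - (incidence src tgt e v * f v))"
      proof -
        have "(\<Sum>e'\<in>edges G - I. Z (Inl e') * ?N (Inl e') (Inl e)) = 0"
          using e by (intro sum.neutral) auto
        moreover have "(\<Sum>v\<in>?V. Z (Inr v) * ?N (Inr v) (Inl e)) = (\<Sum>v\<in>?V. - (incidence src tgt e v * f v))"
          by (intro sum.cong) (auto simp: f_def)
        ultimately show ?thesis by (simp only: rs(2) sum_index_set[OF fin] add_0_left)
      qed
      also have "\<dots> = - (f (src e) - f (tgt e))"
        unfolding sum_negf using fin by (subst sum_incidence) (auto simp: f_def)
      finally show ?thesis by simp
    qed
    have "constant_along G (edges G - J - T - {e0}) f"
      using diff along[of "edges G - J - T - {e0}" f] by (metis Diff_iff Diff_subset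
          eq_iff_diff_eq_0 order_trans singletonI)
    moreover have "\<not> constant_along G {e0} f"
      using diff[OF e0] det e0 along[of "{e0}" f] by auto
    ultimately show "\<exists>f. constant_along G (edges G - J - T - {e0}) f \<and> \<not> constant_along G {e0} f"
      by blast
  qed
qed

text \<open>A kernel vector vanishes in three parts. Its vertex part is a potential constant along a
  spanning set, hence 0. The rows of \<open>T\<close> kill its entries on \<open>T\<close>. What
  remains is a flow on a forest, which must be 0.\<close>

lemma det_coefficient_matrix_nonzeroI:
  fixes G :: "('v, 'e) multigraph"
  assumes fin: "finite (verts G)" "finite (edges G)"
    and wf: "\<And>e. e \<in> edges G \<Longrightarrow> ends G e \<subseteq> verts G"
    and orient: "orientation G src tgt"
    and rs: "set rs = index_set G r I"
    and cs: "distinct cs" "set cs = index_set G r J"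
    and len: "length rs = length cs"
    and r: "r \<in> verts G" and T: "T \<subseteq> edges G - I"
    and spanning: "spanning G (edges G - I - T)" and forest: "forest G (edges G - J - T)"
  shows "det (indexed_mat rs cs (coefficient_matrix src tgt T)) \<noteq> 0"
proof (rule det_indexed_mat_nonzeroI[OF cs(1) len])
  let ?N = "coefficient_matrix src tgt T" and ?V = "verts G - {r}"
  have in_verts: "src e \<in> verts G" "tgt e \<in> verts G" if "e \<in> edges G" for e
    using orient wf[OF that] that by (auto simp: orientation_def)
  note along = constant_along_orientation[OF orient]
  fix X c
  assume ker: "\<And>a. a \<in> set rs \<Longrightarrow> (\<Sum>c\<in>set cs. ?N a c * X c) = 0" and c: "c \<in> set cs"
  define y where "y v = (if v \<in> ?V then X (Inr v) else 0)" for v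
  have edge_row: "(\<Sum>f\<in>edges G - J. of_bool (e = f \<and> e \<in> T) * X (Inl f)) +
      (if e \<in> T then 0 else y (src e) - y (tgt e)) = 0" if e: "e \<in> edges G - I" for e
  proof -
    have "(\<Sum>v\<in>?V. incidence src tgt e v * X (Inr v)) = (\<Sum>v\<in>?V. incidence src tgt e v * y v)"
      by (intro sum.cong) (auto simp: y_def)
    also have "\<dots> = y (src e) - y (tgt e)"
      using fin by (intro sum_incidence) (auto simp: y_def)
    finally have y: "(\<Sum>v\<in>?V. incidence src tgt e v * X (Inr v)) = y (src e) - y (tgt e)" .
    have "Inl e \<in> set rs" using e by (simp add: rs index_set_def)
    from ker[OF this] fin y show ?thesis
      by (cases "e \<in> T") (simp_all add: cs(2) sum_index_set)
  qed
  have "y (src e) = y (tgt e)" if "e \<in> edges G - I - T" for e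
    using edge_row[of e] that by auto
  then have "constant_along G (edges G - I - T) y"
    using along[of "edges G - I - T" y] by blast
  then have "y v = y r" if "v \<in> verts G" for v
    using spanning r that unfolding spanning_def by blast
  then have vert_zero: "X (Inr v) = 0" if "v \<in> ?V" for v
  proof -
    have "y v = y r" using that \<open>\<And>v. v \<in> verts G \<Longrightarrow> y v = y r\<close> by blast
    then show ?thesis using that by (simp add: y_def)
  qed
  have T_zero: "X (Inl e) = 0" if "e \<in> T" "e \<in> edges G - J" for e
  proof -
    have "(\<Sum>f\<in>edges G - J. of_bool (e = f \<and> e \<in> T) * X (Inl f)) =
        (\<Sum>f\<in>edges G - J. if f = e then X (Inl e) else 0)"
      using that by (intro sum.cong) auto
    then show ?thesis using edge_row[of e] that T fin by auto
  qed
  have forest_zero: "X (Inl e0) = 0" if e0: "e0 \<in> edges G - J - T" for e0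
  proof -
    obtain f :: "'v \<Rightarrow> int" where f: "constant_along G (edges G - J - T - {e0}) f"
      and f0: "\<not> constant_along G {e0} f"
      using forest e0 unfolding forest_def by blast
    \<comment> \<open>The vertex rows express conservation of the flow at every vertex except
      \<open>r\<close>.\<close>
    have 0: "(\<Sum>e\<in>edges G - J. incidence src tgt e v * X (Inl e)) = 0" if "v \<in> ?V" for v
    proof -
      have "Inr v \<in> set rs" using that by (simp add: rs index_set_def)
      from ker[OF this] fin show ?thesis by (simp add: cs(2) sum_index_set sum_negf)
    qed
    \<comment> \<open>The flow is paired with the potential that separates \<open>e0\<close>. Its
      normalisation at \<open>r\<close> hides the vertex where conservation is not among the
      equations. After exchanging the sums, only the term of \<open>e0\<close> survives.\<close>
    have "0 = (\<Sum>v\<in>?V. (f v - f r) * (\<Sum>e\<in>edges G - J. incidence src tgt e v * X (Inl e)))"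
      by (simp add: 0)
    also have "\<dots> = (\<Sum>e\<in>edges G - J. X (Inl e) * (\<Sum>v\<in>?V. incidence src tgt e v * (f v - f r)))"
      by (simp add: sum_distrib_left sum_distrib_right) (subst sum.swap, simp add: algebra_simps)
    also have "\<dots> = (\<Sum>e\<in>edges G - J. X (Inl e) * (f (src e) - f (tgt e)))"
    proof (rule sum.cong)
      fix e assume "e \<in> edges G - J"
      then have "(\<Sum>v\<in>?V. incidence src tgt e v * (f v - f r)) = f (src e) - f (tgt e)"
        using fin in_verts by (subst sum_incidence) auto
      then show "X (Inl e) * (\<Sum>v\<in>?V. incidence src tgt e v * (f v - f r)) =
          X (Inl e) * (f (src e) - f (tgt e))" by simp
    qed simp
    also have "\<dots> = (\<Sum>e\<in>edges G - J. if e = e0 then X (Inl e0) * (f (src e0) - f (tgt e0)) else 0)"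
    proof (rule sum.cong)
      fix e assume e: "e \<in> edges G - J"
      have "f (src e) = f (tgt e)" if "e \<notin> T" "e \<noteq> e0"
        using f e that along[of "edges G - J - T - {e0}" f] by blast
      then show "X (Inl e) * (f (src e) - f (tgt e)) =
          (if e = e0 then X (Inl e0) * (f (src e0) - f (tgt e0)) else 0)"
        using T_zero e by auto
    qed simp
    also have "\<dots> = X (Inl e0) * (f (src e0) - f (tgt e0))"
      using e0 fin by simp
    finally show ?thesis using f0 e0 along[of "{e0}" f] by auto
  qed
  show "X c = 0"
    using c vert_zero T_zero forest_zero by (auto simp: cs(2) index_set_def)
qed

lemma det_graph_matrix_nonzero_iff_spanning_forest:
  fixes G :: "('v, 'e) multigraph"
  assumes fin: "finite (verts G)" "finite (edges G)"
    and wf: "\<And>e. e \<in> edges G \<Longrightarrow> ends G e \<subseteq> verts G"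
    and orient: "orientation G src tgt"
    and rs: "distinct rs" "set rs = index_set G r I"
    and cs: "distinct cs" "set cs = index_set G r J"
    and len: "length rs = length cs"
    and r: "r \<in> verts G"
  shows "det (indexed_mat rs cs (graph_matrix src tgt K)) \<noteq> 0 \<longleftrightarrow>
    (\<exists>T \<subseteq> edges G - (I \<union> J \<union> K). spanning G (edges G - I - T) \<and> forest G (edges G - J - T))"
proof -
  have "finite T \<and> Inl ` T \<subseteq> set rs \<and> T \<inter> K = {} \<and>
        det (indexed_mat rs cs (coefficient_matrix src tgt T)) \<noteq> 0 \<longleftrightarrow>
      T \<subseteq> edges G - (I \<union> J \<union> K) \<and> spanning G (edges G - I - T) \<and> forest G (edges G - J - T)"
    (is "?l \<longleftrightarrow> ?r") for T
  proof
    assume l: ?l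
    then have "T \<subseteq> edges G - I" by (auto simp: rs(2) index_set_def)
    moreover have "T \<inter> J = {}"
    proof (rule ccontr)
      assume "T \<inter> J \<noteq> {}"
      then obtain e where e: "e \<in> T" "e \<in> J" by blast
      \<comment> \<open>The row of \<open>e\<close> has its only nonzero entry in the column of
        \<open>e\<close>, which is deleted because \<open>e\<close> is in \<open>J\<close>. A zero
        row is the case \<open>C = {}\<close> of the cardinality bound.\<close>
      have "card {Inl e :: 'e + 'v} \<le> card ({} :: ('e + 'v) set)"
        using e l by (intro card_rows_le_card_columns[OF rs(1) cs(1) len, of "coefficient_matrix src tgt T"])
          (auto simp: coefficient_matrix_row_in cs(2) index_set_def)
      then show False by simp
    qed
    moreover have "spanning G (edges G - I - T)" "forest G (edges G - J - T)"
      using det_coefficient_matrix_nonzeroD[OF fin wf orient rs cs len r] l by blast+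
    ultimately show ?r using l by blast
  next
    assume ?r
    then have "T \<subseteq> edges G - I" by blast
    moreover from this have "finite T" "Inl ` T \<subseteq> set rs"
      using fin finite_subset by (auto simp: rs(2) index_set_def)
    ultimately show ?l
      using det_coefficient_matrix_nonzeroI[OF fin wf orient rs(2) cs len r] \<open>?r\<close> by blast
  qed
  then show ?thesis using det_graph_matrix_nonzero_iff[OF rs(1) len] by simp
qed

section \<open>Splitting in terms of trees\<close>

definition dodgson_triple :: "'e set \<Rightarrow> 'e set \<Rightarrow> 'e set \<Rightarrow> 'e set \<Rightarrow> bool" where
  "dodgson_triple S I J K \<longleftrightarrow> I \<union> J \<union> K = S \<and> K \<inter> (I \<union> J) = {} \<and>
    (card I = 2 \<and> card J = 2 \<and> I \<inter> J = {} \<and> card K = 1 \<or>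
     card I = 3 \<and> card J = 3 \<and> card (I \<inter> J) = 1 \<and> K = {})"

text \<open>For a triple of edges of a finite graph, \<open>S - I\<close> and \<open>S - J\<close>
  have the same size. One set spanning and the other being a forest then makes both of them spanning
  trees.\<close>

definition tree_pair :: "('v, 'e) multigraph \<Rightarrow> 'e set \<Rightarrow> 'e set \<Rightarrow> 'e set \<Rightarrow> bool" where
  "tree_pair G S I J \<longleftrightarrow>
    (\<exists>F \<subseteq> edges G - S. spanning G (F \<union> (S - I)) \<and> forest G (F \<union> (S - J)))"

lemma dodgson_triple_swap: "dodgson_triple S I J K \<Longrightarrow> dodgson_triple S J I K"
  by (auto simp: dodgson_triple_def Int_commute Un_commute)

lemma config_dodgsons_iff:
  "D \<in> config_dodgsons G S \<longleftrightarrow> (\<exists>I J K. dodgson_triple S I J K \<and> D \<in> dodgson G I J K)"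
  unfolding config_dodgsons_def dodgson_triple_def by blast

lemma dodgson_iff:
  "D \<in> dodgson G I J K \<longleftrightarrow> (\<exists>src tgt r rs cs. D = det (indexed_mat rs cs (graph_matrix src tgt K)) \<and>
     orientation G src tgt \<and> r \<in> verts G \<and>
     distinct rs \<and> set rs = index_set G r I \<and> distinct cs \<and> set cs = index_set G r J)"
  unfolding dodgson_def indexed_mat_def by simp

lemma card_index_set:
  assumes "finite (verts G)" "finite (edges G)" "I \<subseteq> edges G"
  shows "card (index_set G r I) = card (edges G) - card I + card (verts G - {r})"
  unfolding index_set_def using assms
  by (subst card_Un_disjoint) (auto simp: card_image card_Diff_subset finite_subset)

lemma length_index_set:
  assumes "finite (verts G)" "finite (edges G)" "S \<subseteq> edges G" "dodgson_triple S I J K"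
    and "distinct rs" "set rs = index_set G r I" "distinct cs" "set cs = index_set G r J"
  shows "length rs = length cs"
proof -
  have "I \<subseteq> edges G" "J \<subseteq> edges G" "card I = card J"
    using assms(3,4) by (auto simp: dodgson_triple_def)
  then have "card (index_set G r I) = card (index_set G r J)"
    using assms(1,2) by (simp add: card_index_set)
  then show ?thesis using assms(5-8) by (metis distinct_card)
qed

lemma exists_orientation:
  assumes "finite_multigraph G"
  obtains src tgt where "orientation G src tgt"
proof -
  have "\<exists>p. e \<in> edges G \<longrightarrow> ends G e = {fst p, snd p}" for e
  proof (cases "e \<in> edges G")
    case True
    then consider "card (ends G e) = 1" | "card (ends G e) = 2"
      using assms by (auto simp: finite_multigraph_def)
    then obtain a b where "ends G e = {a, b}"
      by cases (metis card_1_singletonE insert_absorb2, metis card_2_iff)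
    then show ?thesis by (intro exI[of _ "(a, b)"]) simp
  qed simp
  then obtain p where "\<And>e. e \<in> edges G \<Longrightarrow> ends G e = {fst (p e), snd (p e)}" by metis
  then have "orientation G (\<lambda>e. fst (p e)) (\<lambda>e. snd (p e))" by (simp add: orientation_def)
  then show ?thesis by (rule that)
qed

text \<open>The deleted vertex \<open>r\<close> is left free, so that it can later be chosen as the
  cut vertex.\<close>

lemma not_config_splits_nonzero_det:
  assumes "finite_multigraph G" "S \<subseteq> edges G" "\<not> config_splits G S"
    and "dodgson_triple S I J K" "r \<in> verts G"
  obtains src tgt rs cs where "orientation G src tgt"
    "distinct rs" "set rs = index_set G r I" "distinct cs" "set cs = index_set G r J"
    "length rs = length cs" "det (indexed_mat rs cs (graph_matrix src tgt K)) \<noteq> 0"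
proof -
  have fin: "finite (verts G)" "finite (edges G)"
    using assms(1) by (auto simp: finite_multigraph_def)
  then have "finite (index_set G r A)" for A by (simp add: index_set_def)
  then obtain rs cs where l: "distinct rs" "set rs = index_set G r I" "distinct cs" "set cs = index_set G r J"
    using finite_distinct_list by metis
  obtain src tgt where o: "orientation G src tgt" using exists_orientation[OF assms(1)] .
  have "det (indexed_mat rs cs (graph_matrix src tgt K)) \<in> config_dodgsons G S"
    using o l assms(4,5) unfolding config_dodgsons_iff dodgson_iff by blast
  then have "det (indexed_mat rs cs (graph_matrix src tgt K)) \<noteq> 0"
    using assms(3) unfolding config_splits_def by metis
  with o l length_index_set[OF fin assms(2,4) l] show ?thesis by (rule that)
qed

lemma det_graph_matrix_nonzero_iff_tree_pair:
  assumes "finite (verts G)" "finite (edges G)" "\<And>e. e \<in> edges G \<Longrightarrow> ends G e \<subseteq> verts G"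
    and "orientation G src tgt" "distinct rs" "set rs = index_set G r I"
    and "distinct cs" "set cs = index_set G r J" "r \<in> verts G"
    and S: "S \<subseteq> edges G" and triple: "dodgson_triple S I J K"
  shows "det (indexed_mat rs cs (graph_matrix src tgt K)) \<noteq> 0 \<longleftrightarrow> tree_pair G S I J"
proof -
  have IJK: "I \<union> J \<union> K = S" using triple by (simp add: dodgson_triple_def)
  note len = length_index_set[OF assms(1,2) S triple assms(5-8)]
  \<comment> \<open>\<open>T\<close> and \<open>F\<close> are complements of each other in
    \<open>edges G - S\<close>.\<close>
  have "(\<exists>T \<subseteq> edges G - S. spanning G (edges G - I - T) \<and> forest G (edges G - J - T)) \<longleftrightarrow>
      tree_pair G S I J"
  proof -
    have "edges G - I - T = (edges G - S - T) \<union> (S - I)"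
      "edges G - J - T = (edges G - S - T) \<union> (S - J)" if "T \<subseteq> edges G - S" for T
      using that IJK S by auto
    moreover have "edges G - S - (edges G - S - F) = F" if "F \<subseteq> edges G - S" for F
      using that by blast
    ultimately show ?thesis unfolding tree_pair_def by (metis Diff_subset)
  qed
  then show ?thesis
    using det_graph_matrix_nonzero_iff_spanning_forest[OF assms(1-8) len assms(9), of K]
    unfolding IJK by simp
qed

lemma not_config_splits_tree_pair:
  assumes "finite_multigraph G" "S \<subseteq> edges G" "\<not> config_splits G S"
    and "dodgson_triple S I J K" "verts G \<noteq> {}"
  shows "tree_pair G S I J"
proof -
  have fin: "finite (verts G)" "finite (edges G)" "\<And>e. e \<in> edges G \<Longrightarrow> ends G e \<subseteq> verts G"
    using assms(1) by (auto simp: finite_multigraph_def)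
  obtain r where r: "r \<in> verts G" using assms(5) by blast
  obtain src tgt rs cs where "orientation G src tgt"
    "distinct rs" "set rs = index_set G r I" "distinct cs" "set cs = index_set G r J"
    "det (indexed_mat rs cs (graph_matrix src tgt K)) \<noteq> 0"
    by (rule not_config_splits_nonzero_det[OF assms(1-4) r])
  then show ?thesis
    using det_graph_matrix_nonzero_iff_tree_pair[OF fin _ _ _ _ _ r assms(2,4)] by blast
qed

text \<open>Being a tree pair does not depend on orientation, deleted vertex or order of rows and
  columns, so none of the values collected in \<open>config_dodgsons\<close> can be 0.\<close>

lemma not_config_splitsI:
  assumes fin: "finite (verts G)" "finite (edges G)" "\<And>e. e \<in> edges G \<Longrightarrow> ends G e \<subseteq> verts G"
    and S: "S \<subseteq> edges G"
    and pairs: "\<And>I J K. dodgson_triple S I J K \<Longrightarrow> tree_pair G S I J"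
  shows "\<not> config_splits G S"
proof
  assume "config_splits G S"
  then obtain D I J K where D: "D = 0" "dodgson_triple S I J K" "D \<in> dodgson G I J K"
    unfolding config_splits_def Bex_def config_dodgsons_iff by (elim exE conjE)
  from D(3) obtain src tgt r rs cs where *:
    "D = det (indexed_mat rs cs (graph_matrix src tgt K))" "orientation G src tgt" "r \<in> verts G"
    "distinct rs" "set rs = index_set G r I" "distinct cs" "set cs = index_set G r J"
    unfolding dodgson_iff by (elim exE conjE)
  then show False
    using det_graph_matrix_nonzero_iff_tree_pair[OF fin *(2,4,5,6,7,3) S D(2)] pairs[OF D(2)] D(1) *(1)
    by simp
qed

section \<open>Tree pairs under deletion and contraction\<close>

lemma constant_alongD:
  "constant_along G P f \<Longrightarrow> e \<in> P \<Longrightarrow> u \<in> ends G e \<Longrightarrow> w \<in> ends G e \<Longrightarrow> f u = f w"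
  unfolding constant_along_def by blast

lemma delete_edge_simps [simp]:
  "verts (delete_edge G e) = verts G" "edges (delete_edge G e) = edges G - {e}"
  "ends (delete_edge G e) = ends G"
  by (simp_all add: delete_edge_def)

lemma contract_edge_simps [simp]:
  "verts (contract_edge G e) = merge_ends G e ` verts G"
  "edges (contract_edge G e) = edges G - {e}"
  "ends (contract_edge G e) f = merge_ends G e ` ends G f"
  by (simp_all add: contract_edge_def)

lemma tree_pair_delete_edge:
  assumes "F \<subseteq> edges G - S" "e \<notin> F"
    and "spanning G (F \<union> (S - I))" "forest G (F \<union> (S - J))"
  shows "tree_pair (delete_edge G e) S I J"
proof -
  have "constant_along (delete_edge G e) = constant_along G"
    by (simp add: constant_along_def fun_eq_iff)
  then have "spanning (delete_edge G e) = spanning G" "forest (delete_edge G e) = forest G"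
    by (simp_all add: spanning_def forest_def fun_eq_iff)
  moreover have "F \<subseteq> edges (delete_edge G e) - S" using assms(1,2) by auto
  ultimately show ?thesis using assms(3,4) unfolding tree_pair_def by metis
qed

text \<open>A potential on the contraction pulls back along \<open>merge_ends\<close>, and the
  pullback is constant on the ends of \<open>e\<close>.\<close>

lemma spanning_contract_edge:
  assumes "spanning G P"
  shows "spanning (contract_edge G e) (P - {e})"
  unfolding spanning_def
proof (intro allI impI)
  fix f :: "'a \<Rightarrow> int"
  assume f: "constant_along (contract_edge G e) (P - {e}) f"
  have "constant_along G P (\<lambda>v. f (merge_ends G e v))"
    unfolding constant_along_def
  proof (intro ballI)
    fix p u w assume "p \<in> P" "u \<in> ends G p" "w \<in> ends G p"
    then show "f (merge_ends G e u) = f (merge_ends G e w)"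
      using f by (cases "p = e") (auto simp: constant_along_def merge_ends_def)
  qed
  then show "\<forall>u\<in>verts (contract_edge G e). \<forall>w\<in>verts (contract_edge G e). f u = f w"
    using assms unfolding spanning_def by auto
qed

text \<open>Because \<open>e\<close> is in \<open>P\<close>, a potential that separates another edge
  \<open>p\<close> is constant on the ends of \<open>e\<close> and so descends to the
  contraction.\<close>

lemma forest_contract_edge:
  assumes "forest G P" "e \<in> P"
  shows "forest (contract_edge G e) (P - {e})"
  unfolding forest_def
proof
  fix p assume p: "p \<in> P - {e}"
  then obtain f where f: "constant_along G (P - {p}) f" "\<not> constant_along G {p} f"
    using assms(1) unfolding forest_def by blast
  have merge: "f (merge_ends G e u) = f u" for u
  proof (cases "u \<in> ends G e")
    case True
    then have "merge_ends G e u \<in> ends G e" by (auto simp: merge_ends_def intro: someI)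
    then show ?thesis using f(1) True p assms(2) unfolding constant_along_def by blast
  qed (simp add: merge_ends_def)
  have "constant_along (contract_edge G e) (P - {e} - {p}) f"
    using f(1) by (auto simp: constant_along_def merge)
  moreover have "\<not> constant_along (contract_edge G e) {p} f"
    using f(2) by (auto simp: constant_along_def merge)
  ultimately show "\<exists>f. constant_along (contract_edge G e) (P - {e} - {p}) f \<and>
      \<not> constant_along (contract_edge G e) {p} f" by blast
qed

lemma tree_pair_contract_edge:
  assumes "F \<subseteq> edges G - S" "e \<in> F"
    and "spanning G (F \<union> (S - I))" "forest G (F \<union> (S - J))"
  shows "tree_pair (contract_edge G e) S I J"
proof -
  have "F \<union> (S - A) - {e} = (F - {e}) \<union> (S - A)" for A using assms(1,2) by blast
  moreover have "F - {e} \<subseteq> edges (contract_edge G e) - S" using assms(1) by auto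
  ultimately show ?thesis
    unfolding tree_pair_def
    using spanning_contract_edge[OF assms(3), of e] forest_contract_edge[OF assms(4), of e] assms(2)
    by (metis UnI1)
qed

section \<open>Gluing along a cut vertex\<close>

text \<open>\<open>X\<close> holds the vertices of one side other than \<open>v\<close>, and
  \<open>A\<close> the edges of that side. A loop at \<open>v\<close> may belong to either
  side.\<close>

definition separation :: "('v, 'e) multigraph \<Rightarrow> 'v \<Rightarrow> 'v set \<Rightarrow> 'e set \<Rightarrow> bool" where
  "separation G v X A \<longleftrightarrow> v \<in> verts G \<and> X \<subseteq> verts G - {v} \<and> A \<subseteq> edges G \<and>
    (\<forall>e\<in>A. ends G e \<subseteq> insert v X) \<and> (\<forall>e\<in>edges G - A. ends G e \<inter> X = {})"

lemma separation_complement: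
  assumes "finite_multigraph G" "separation G v X A"
  shows "separation G v (verts G - insert v X) (edges G - A)"
  using assms unfolding separation_def finite_multigraph_def by blast

text \<open>Each side is tested separately: replacing a potential by its value at \<open>v\<close>
  on the opposite side keeps it constant along \<open>P\<close> (or \<open>Q\<close>), so it is
  constant on that side.\<close>

lemma spanning_glue:
  assumes "separation G v X A" "P \<subseteq> edges G" "Q \<subseteq> edges G" "spanning G P" "spanning G Q"
  shows "spanning G (P \<inter> A \<union> (Q - A))"
  unfolding spanning_def
proof (intro allI impI)
  fix f :: "'a \<Rightarrow> int"
  assume f: "constant_along G (P \<inter> A \<union> (Q - A)) f"
  have A: "ends G e \<subseteq> insert v X" if "e \<in> A" for e using assms(1) that by (auto simp: separation_def)
  have B: "ends G e \<inter> X = {}" if "e \<in> edges G - A" for e using assms(1) that by (auto simp: separation_def)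
  have v: "v \<in> verts G" "v \<notin> X" using assms(1) by (auto simp: separation_def)
  have "constant_along G P (\<lambda>u. if u \<in> X then f u else f v)"
    unfolding constant_along_def
  proof (intro ballI)
    fix p u w assume p: "p \<in> P" "u \<in> ends G p" "w \<in> ends G p"
    show "(if u \<in> X then f u else f v) = (if w \<in> X then f w else f v)"
    proof (cases "p \<in> A")
      case True
      then have "f u = f w" using p by (intro constant_alongD[OF f, of p]) auto
      then show ?thesis using A[OF True] p by auto
    next
      case False
      then show ?thesis using B[of p] p assms(2) by auto
    qed
  qed
  then have 1: "(if u \<in> X then f u else f v) = (if v \<in> X then f v else f v)" if "u \<in> verts G" for u
    using assms(4) v that unfolding spanning_def by blast
  have "constant_along G Q (\<lambda>u. if u \<in> X then f v else f u)"
    unfolding constant_along_def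
  proof (intro ballI)
    fix p u w assume p: "p \<in> Q" "u \<in> ends G p" "w \<in> ends G p"
    show "(if u \<in> X then f v else f u) = (if w \<in> X then f v else f w)"
    proof (cases "p \<in> A")
      case True
      then show ?thesis using A[OF True] p by auto
    next
      case False
      then have "f u = f w" using p by (intro constant_alongD[OF f, of p]) auto
      then show ?thesis using False B[of p] p assms(3) by auto
    qed
  qed
  then have 2: "(if u \<in> X then f v else f u) = (if v \<in> X then f v else f v)" if "u \<in> verts G" for u
    using assms(5) v that unfolding spanning_def by blast
  have "f u = f v" if "u \<in> verts G" for u
    using 1[OF that] 2[OF that] by (cases "u \<in> X") auto
  then show "\<forall>u\<in>verts G. \<forall>w\<in>verts G. f u = f w" by simp
qed

text \<open>A potential that separates an edge on one side can be flattened to its value at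
  \<open>v\<close> on the other side, whose edges then impose no condition.\<close>

lemma forest_glue:
  assumes "separation G v X A" "P \<subseteq> edges G" "Q \<subseteq> edges G" "forest G P" "forest G Q"
  shows "forest G (P \<inter> A \<union> (Q - A))"
  unfolding forest_def
proof
  fix e assume e: "e \<in> P \<inter> A \<union> (Q - A)"
  have A: "ends G e \<subseteq> insert v X" if "e \<in> A" for e using assms(1) that by (auto simp: separation_def)
  have B: "ends G e \<inter> X = {}" if "e \<in> edges G - A" for e using assms(1) that by (auto simp: separation_def)
  have v: "v \<notin> X" using assms(1) by (auto simp: separation_def)
  show "\<exists>f. constant_along G (P \<inter> A \<union> (Q - A) - {e}) f \<and> \<not> constant_along G {e} f"
  proof (cases "e \<in> A")
    case True
    then obtain f where f: "constant_along G (P - {e}) f" "\<not> constant_along G {e} f"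
      using assms(4) e unfolding forest_def by blast
    let ?g = "\<lambda>u. if u \<in> X then f u else f v"
    have g: "?g u = f u" if "p \<in> A" "u \<in> ends G p" for p u using A[OF that(1)] that(2) by auto
    have "constant_along G (P \<inter> A \<union> (Q - A) - {e}) ?g"
      unfolding constant_along_def
    proof (intro ballI)
      fix p u w assume p: "p \<in> P \<inter> A \<union> (Q - A) - {e}" "u \<in> ends G p" "w \<in> ends G p"
      show "?g u = ?g w"
      proof (cases "p \<in> A")
        case True
        then have "f u = f w" using p by (intro constant_alongD[OF f(1), of p]) auto
        then show ?thesis using g[OF True] p by metis
      next
        case False
        then show ?thesis using B[of p] p assms(3) by auto
      qed
    qed
    moreover have "\<not> constant_along G {e} ?g"
    proof -
      obtain u w where "u \<in> ends G e" "w \<in> ends G e" "f u \<noteq> f w"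
        using f(2) by (auto simp: constant_along_def)
      with g[OF True] show ?thesis unfolding constant_along_def by (metis singletonI)
    qed
    ultimately show ?thesis by blast
  next
    case False
    then obtain f where f: "constant_along G (Q - {e}) f" "\<not> constant_along G {e} f"
      using assms(5) e unfolding forest_def by blast
    let ?g = "\<lambda>u. if u \<in> X then f v else f u"
    have g: "?g u = f u" if "p \<in> edges G - A" "u \<in> ends G p" for p u using B[OF that(1)] that(2) by auto
    have "constant_along G (P \<inter> A \<union> (Q - A) - {e}) ?g"
      unfolding constant_along_def
    proof (intro ballI)
      fix p u w assume p: "p \<in> P \<inter> A \<union> (Q - A) - {e}" "u \<in> ends G p" "w \<in> ends G p"
      show "?g u = ?g w"
      proof (cases "p \<in> A")
        case True
        then show ?thesis using A[OF True] p by auto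
      next
        case False
        then have "f u = f w" using p by (intro constant_alongD[OF f(1), of p]) auto
        moreover have "p \<in> edges G - A" using False p assms(3) by auto
        ultimately show ?thesis using g p by metis
      qed
    qed
    moreover have "\<not> constant_along G {e} ?g"
    proof -
      obtain u w where "u \<in> ends G e" "w \<in> ends G e" "f u \<noteq> f w"
        using f(2) by (auto simp: constant_along_def)
      moreover have "e \<in> edges G - A" using False e assms(3) by auto
      ultimately show ?thesis using g unfolding constant_along_def by (metis singletonI)
    qed
    ultimately show ?thesis by blast
  qed
qed

section \<open>Five-configurations at a cut vertex\<close>

lemma dodgson_triple_pairs:
  "distinct [x, a, b, c, z] \<Longrightarrow> dodgson_triple {x, a, b, c, z} {x, a} {b, c} {z}"
  unfolding dodgson_triple_def by (intro conjI disjI1) auto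

text \<open>Supplies the exchange argument: the two triples share their second set and differ only
  by swapping \<open>x\<close> and \<open>z\<close> between the first and the third.\<close>

lemma dodgson_triple_exists:
  assumes "card S = 5" "x \<in> S" "z \<in> S" "x \<noteq> z"
  obtains a b c where "distinct [x, a, b, c, z]"
    "dodgson_triple S {x, a} {b, c} {z}" "dodgson_triple S {z, a} {b, c} {x}"
proof -
  have "finite S" using assms(1) card.infinite by fastforce
  then have "card (S - {x, z}) = 3" using assms by (subst card_Diff_subset) auto
  then obtain a b c where abc: "S - {x, z} = {a, b, c}" "a \<noteq> b" "b \<noteq> c" "a \<noteq> c"
    by (metis card_3_iff)
  have "{a, b, c} \<inter> {x, z} = {}" unfolding abc(1)[symmetric] by blast
  then have distinct: "distinct [x, a, b, c, z]" "distinct [z, a, b, c, x]"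
    using abc(2-4) assms(4) by auto
  have S: "S = {x, a, b, c, z}" "S = {z, a, b, c, x}" using assms(2,3) abc(1) by blast+
  show ?thesis
    using that distinct(1) dodgson_triple_pairs[OF distinct(1)] dodgson_triple_pairs[OF distinct(2)]
    unfolding S(1)[symmetric] S(2)[symmetric] by blast
qed

lemma distinct_elements:
  assumes "card S = 5"
  obtains x z where "x \<in> S" "z \<in> S" "x \<noteq> z"
proof -
  obtain x T where "S = insert x T" "x \<notin> T" "card T = 4"
    using assms card_Suc_eq[of S 4] by auto
  moreover from this have "T \<noteq> {}" by auto
  ultimately show ?thesis using that by blast
qed

text \<open>Deleting the column of the cut vertex \<open>v\<close> makes the matrix block diagonal, so a nonzero
  determinant has square blocks.\<close>

lemma card_Int_separation:
  assumes "finite_multigraph G" "separation G v X A" "S \<subseteq> edges G" "\<not> config_splits G S"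
    and "dodgson_triple S I J K"
  shows "card (A \<inter> I) = card (A \<inter> J)"
proof -
  have fin: "finite (verts G)" "finite (edges G)"
    using assms(1) by (auto simp: finite_multigraph_def)
  have v: "v \<in> verts G" "v \<notin> X" and X: "X \<subseteq> verts G" and A: "A \<subseteq> edges G"
    using assms(2) by (auto simp: separation_def)
  have finXA: "finite X" "finite A" using X A fin finite_subset by auto
  have "card (A \<inter> J) \<le> card (A \<inter> I)" if triple: "dodgson_triple S I J K" for I J
  proof -
    obtain src tgt rs cs where orient: "orientation G src tgt" and l:
      "distinct rs" "set rs = index_set G v I" "distinct cs" "set cs = index_set G v J"
      "length rs = length cs" "det (indexed_mat rs cs (graph_matrix src tgt K)) \<noteq> 0"
      by (rule not_config_splits_nonzero_det[OF assms(1,3,4) triple v(1)])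
    have side: "{src e, tgt e} \<subseteq> insert v X" if "e \<in> A" for e
      using orient assms(2) A that unfolding orientation_def separation_def by (metis subsetD)
    have other_side: "src e \<notin> X \<and> tgt e \<notin> X" if "e \<in> edges G - A" for e
    proof -
      have "{src e, tgt e} \<inter> X = {}"
        using orient assms(2) that unfolding orientation_def separation_def by (metis DiffD1)
      then show ?thesis by auto
    qed
    let ?C = "\<lambda>J. Inl ` (A - J) \<union> Inr ` X :: ('b + 'a) set"
    have "card (?C I) \<le> card (?C J)"
    proof (rule card_rows_le_card_columns[OF l(1,3,5,6)])
      show "?C I \<subseteq> set rs" using A X v by (auto simp: l(2) index_set_def)
      show "finite (?C J)" using finXA by simp
    next
      fix a c assume a: "a \<in> ?C I" and c: "c \<in> set cs" "c \<notin> ?C J"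
      from c consider (edge) f where "c = Inl f" "f \<in> edges G - A"
        | (vert) w where "c = Inr w" "w \<notin> insert v X"
        by (auto simp: l(4) index_set_def)
      then show "graph_matrix src tgt K a c = 0"
      proof cases
        case edge
        then show ?thesis using a other_side[of f] by (auto simp: incidence_def)
      next
        case vert
        have "incidence src tgt e w = (0 :: 'b mpoly)" if "e \<in> A" for e
          using side[OF that] vert(2) by (auto simp: incidence_def)
        then show ?thesis using a vert by auto
      qed
    qed
    moreover have "card (?C J) = card (A - J) + card X" for J
      using finXA by (subst card_Un_disjoint) (auto simp: card_image)
    ultimately have "card (A - I) \<le> card (A - J)" by simp
    moreover have "card A = card (A \<inter> I) + card (A - I)" "card A = card (A \<inter> J) + card (A - J)"
      using finXA by (metis card_Int_Diff)+
    ultimately show ?thesis by linarith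
  qed
  from this[OF assms(5)] this[OF dodgson_triple_swap[OF assms(5)]] show ?thesis by simp
qed

lemma not_config_splits_one_side:
  assumes "finite_multigraph G" "separation G v X A" "five_configuration G S" "\<not> config_splits G S"
  shows "S \<subseteq> A \<or> S \<subseteq> edges G - A"
proof -
  have S: "S \<subseteq> edges G" "card S = 5" using assms(3) by (auto simp: five_configuration_def)
  have "x \<in> A \<longleftrightarrow> z \<in> A" if xz: "x \<in> S" "z \<in> S" "x \<noteq> z" for x z
  proof -
    obtain a b c where a: "distinct [x, a, b, c, z]"
      and t: "dodgson_triple S {x, a} {b, c} {z}" "dodgson_triple S {z, a} {b, c} {x}"
      using dodgson_triple_exists[OF S(2) xz] by metis
    \<comment> \<open>Both triples have the same second set \<open>{b, c}\<close>.\<close>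
    have "card (A \<inter> {x, a}) = card (A \<inter> {z, a})"
      using t[THEN card_Int_separation[OF assms(1,2) S(1) assms(4)]] by simp
    then show ?thesis using a by (auto simp: Int_insert_right split: if_splits)
  qed
  then show ?thesis using S(1) by blast
qed

text \<open>For the triple \<open>{x, a}\<close>, \<open>{b, c}\<close>, \<open>{z}\<close> the rows
  of \<open>b\<close> and \<open>c\<close> remain while their diagonal columns are deleted. Their
  nonzero entries lie in vertex columns, so at least two vertices other than \<open>r\<close> exist.
  This excludes cut vertices whose removal leaves a trivial graph.\<close>

lemma not_config_splits_card_verts:
  assumes "finite_multigraph G" "five_configuration G S" "\<not> config_splits G S" "verts G \<noteq> {}"
  shows "3 \<le> card (verts G)"
proof -
  have S: "S \<subseteq> edges G" "card S = 5" using assms(2) by (auto simp: five_configuration_def)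
  obtain x z where xz: "x \<in> S" "z \<in> S" "x \<noteq> z" using distinct_elements[OF S(2)] .
  obtain a b c where distinct: "distinct [x, a, b, c, z]"
    and t: "dodgson_triple S {x, a} {b, c} {z}"
    using dodgson_triple_exists[OF S(2) xz] by metis
  obtain r where r: "r \<in> verts G" using assms(4) by blast
  have fin: "finite (verts G)" using assms(1) by (auto simp: finite_multigraph_def)
  have "b \<in> edges G - {x, a}" "c \<in> edges G - {x, a}"
    using t S(1) distinct by (auto simp: dodgson_triple_def)
  moreover obtain src tgt rs cs where
    l: "distinct rs" "set rs = index_set G r {x, a}" "distinct cs" "set cs = index_set G r {b, c}"
      "length rs = length cs" "det (indexed_mat rs cs (graph_matrix src tgt {z})) \<noteq> 0"
    by (rule not_config_splits_nonzero_det[OF assms(1) S(1) assms(3) t r])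
  ultimately have "card {Inl b, Inl c :: 'b + 'a} \<le> card (Inr ` (verts G - {r}) :: ('b + 'a) set)"
    using fin by (intro card_rows_le_card_columns[OF l(1,3,5,6)]) (auto simp: l(2,4) index_set_def)
  then show ?thesis using distinct r fin by (simp add: card_image)
qed

section \<open>A proper minor that is still non-splitting\<close>

text \<open>The witness \<open>F\<^sub>0\<close> on the side avoiding \<open>S\<close> can be shared by all pairs \<open>(I, J)\<close>, so it decides
  uniformly whether an edge on that side is deleted or contracted.\<close>

lemma nonsplitting_minor:
  assumes G: "finite_multigraph G" "separation G v X A"
    and S: "five_configuration G S" "\<not> config_splits G S" "S \<subseteq> A"
    and e: "e \<in> edges G - A"
  shows "\<not> splits (delete_edge G e) \<or> \<not> splits (contract_edge G e)"
proof -
  have fin: "finite (verts G)" "finite (edges G)" "\<And>e. e \<in> edges G \<Longrightarrow> ends G e \<subseteq> verts G"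
    using G(1) by (auto simp: finite_multigraph_def)
  have S': "S \<subseteq> edges G" "card S = 5" using S(1) by (auto simp: five_configuration_def)
  have V: "verts G \<noteq> {}" and A: "A \<subseteq> edges G" using G(2) by (auto simp: separation_def)
  note pair = not_config_splits_tree_pair[OF G(1) S'(1) S(2) _ V]
  obtain x z where "x \<in> S" "z \<in> S" "x \<noteq> z" using distinct_elements[OF S'(2)] .
  then obtain I0 J0 K0 where "dodgson_triple S I0 J0 K0" using dodgson_triple_exists[OF S'(2)] by metis
  then obtain F0 where F0: "F0 \<subseteq> edges G - S" "spanning G (F0 \<union> (S - I0))" "forest G (F0 \<union> (S - J0))"
    using pair unfolding tree_pair_def by metis
  \<comment> \<open>The witness of each triple is kept inside \<open>A\<close> and replaced by
    \<open>F0\<close> outside.\<close>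
  have glued: "\<exists>F \<subseteq> edges G - S. F - A = F0 - A \<and> spanning G (F \<union> (S - I)) \<and> forest G (F \<union> (S - J))"
    if triple: "dodgson_triple S I J K" for I J K
  proof -
    obtain F where F: "F \<subseteq> edges G - S" "spanning G (F \<union> (S - I))" "forest G (F \<union> (S - J))"
      using pair[OF triple] unfolding tree_pair_def by metis
    let ?F = "F \<inter> A \<union> (F0 - A)"
    \<comment> \<open>Since \<open>S\<close> lies in \<open>A\<close>, the set \<open>S - B'\<close>
      disappears outside \<open>A\<close>. The triple that produced \<open>F0\<close> therefore
      leaves no trace except \<open>F0 - A\<close>.\<close>
    have mix: "(F \<union> (S - B)) \<inter> A \<union> (F0 \<union> (S - B') - A) = ?F \<union> (S - B)" for B B' using S(3) by blast
    have sub: "F \<union> (S - B) \<subseteq> edges G" "F0 \<union> (S - B) \<subseteq> edges G" for B using F F0 S'(1) by auto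
    have "spanning G (?F \<union> (S - I))"
      using spanning_glue[OF G(2) sub F(2) F0(2)] unfolding mix .
    moreover have "forest G (?F \<union> (S - J))"
      using forest_glue[OF G(2) sub F(3) F0(3)] unfolding mix .
    moreover have "?F \<subseteq> edges G - S" "?F - A = F0 - A" using F(1) F0(1) by auto
    ultimately show ?thesis by blast
  qed
  have eS: "S \<subseteq> edges G - {e}" using S(3) S'(1) e by auto
  show ?thesis
  proof (cases "e \<in> F0")
    case True
    have "tree_pair (contract_edge G e) S I J" if triple: "dodgson_triple S I J K" for I J K
    proof -
      obtain F where F: "F \<subseteq> edges G - S" "F - A = F0 - A"
        "spanning G (F \<union> (S - I))" "forest G (F \<union> (S - J))"
        using glued[OF triple] by metis
      from F(2) have "e \<in> F" using True e by blast
      from tree_pair_contract_edge[OF F(1) this F(3,4)] show ?thesis .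
    qed
    moreover have "ends (contract_edge G e) p \<subseteq> verts (contract_edge G e)" if "p \<in> edges G" for p
      using fin(3)[OF that] by (simp add: image_mono)
    ultimately have "\<not> config_splits (contract_edge G e) S"
      using fin(1,2) eS by (intro not_config_splitsI) simp_all
    then show ?thesis using eS S'(2) unfolding splits_def five_configuration_def by auto
  next
    case False
    have "tree_pair (delete_edge G e) S I J" if triple: "dodgson_triple S I J K" for I J K
    proof -
      obtain F where F: "F \<subseteq> edges G - S" "F - A = F0 - A"
        "spanning G (F \<union> (S - I))" "forest G (F \<union> (S - J))"
        using glued[OF triple] by metis
      from F(2) have "e \<notin> F" using False e by blast
      from tree_pair_delete_edge[OF F(1) this F(3,4)] show ?thesis .
    qed
    then have "\<not> config_splits (delete_edge G e) S"
      using fin eS by (intro not_config_splitsI) auto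
    then show ?thesis using eS S'(2) unfolding splits_def five_configuration_def by auto
  qed
qed

section \<open>From a cut vertex to a separation\<close>

text \<open>\<open>X\<close> is the component of a vertex \<open>u\<close> in the graph without
  \<open>v\<close>, and \<open>A\<close> the set of edges meeting \<open>X\<close>; such an edge can
  leave \<open>X\<close> only towards \<open>v\<close>. Connectedness of \<open>G\<close> gives an
  edge at \<open>u\<close>, which lies in \<open>A\<close>, and an edge at a vertex \<open>w\<close>
  of another component, which does not.\<close>

lemma cut_vertex_separation:
  assumes G: "finite_multigraph G" "connected_multigraph G" and v: "cut_vertex G v"
    and card: "3 \<le> card (verts G)"
  obtains X A where "separation G v X A" "A \<noteq> {}" "edges G - A \<noteq> {}"
proof -
  let ?H = "induced G (verts G - {v})"
  have vG: "v \<in> verts G" using v by (simp add: cut_vertex_def)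
  then have "2 \<le> card (verts G - {v})" using card by simp
  moreover from this have "verts G - {v} \<noteq> {}" by (metis card.empty not_numeral_le_zero)
  ultimately have "\<not> trivial_multigraph ?H" "verts ?H \<noteq> {}"
    by (auto simp: trivial_multigraph_def induced_def)
  then obtain u w where u: "u \<in> verts G - {v}" and w: "w \<in> verts G - {v}"
    and uw: "(u, w) \<notin> (adjacency ?H)\<^sup>*"
    using v by (auto simp: cut_vertex_def connected_multigraph_def induced_def)
  define X where "X = {x \<in> verts G - {v}. (u, x) \<in> (adjacency ?H)\<^sup>*}"
  define A where "A = {e \<in> edges G. ends G e \<inter> X \<noteq> {}}"
  have "ends G e \<subseteq> insert v X" if "e \<in> A" for e
  proof
    fix y assume y: "y \<in> ends G e"
    obtain x where x: "x \<in> ends G e" "x \<in> X" using \<open>e \<in> A\<close> by (auto simp: A_def)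
    have e: "e \<in> edges G" "ends G e \<subseteq> verts G" "card (ends G e) \<in> {1, 2}"
      using \<open>e \<in> A\<close> G(1) by (auto simp: A_def finite_multigraph_def)
    show "y \<in> insert v X"
    proof (rule ccontr)
      assume y': "y \<notin> insert v X"
      then have "x \<noteq> y" using x by auto
      have "ends G e = {x, y}"
      proof (rule card_seteq[symmetric])
        show "finite (ends G e)" using e(3) by (auto intro: card_ge_0_finite)
      qed (use x y e(3) \<open>x \<noteq> y\<close> in auto)
      moreover have "x \<noteq> v" using x by (auto simp: X_def)
      ultimately have "(x, y) \<in> adjacency ?H"
        using e y' by (auto simp: adjacency_def induced_def)
      then have "y \<in> X" using x y y' e by (auto simp: X_def intro: rtrancl_into_rtrancl)
      then show False using y' by blast
    qed
  qed
  then have sep: "separation G v X A" using vG by (auto simp: separation_def A_def X_def)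
  \<comment> \<open>The first step of a walk from \<open>x\<close> to a different vertex
    \<open>y\<close> uses an edge at \<open>x\<close>.\<close>
  have edge_at: "\<exists>e\<in>edges G. x \<in> ends G e" if xy: "x \<in> verts G" "y \<in> verts G" "x \<noteq> y" for x y
  proof -
    have "(x, y) \<in> (adjacency G)\<^sup>*" using G(2) xy by (auto simp: connected_multigraph_def)
    then obtain z where "(x, z) \<in> adjacency G" using xy(3) by (metis converse_rtranclE)
    then show ?thesis by (auto simp: adjacency_def)
  qed
  have "u \<in> X" "w \<notin> X" using u w uw by (auto simp: X_def)
  then have "u \<noteq> w" by blast
  have "A \<noteq> {}" using edge_at[of u w] u w \<open>u \<noteq> w\<close> \<open>u \<in> X\<close> by (auto simp: A_def)
  moreover obtain e where "e \<in> edges G" "w \<in> ends G e" using edge_at[of w u] u w \<open>u \<noteq> w\<close> by auto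
  then have "e \<in> edges G - A"
    using sep w \<open>w \<notin> X\<close> unfolding separation_def by blast
  ultimately show ?thesis using sep that by blast
qed

theorem theorem25:
  fixes G :: "('v, 'e) multigraph"
  assumes "finite_multigraph G"
    and "connected_multigraph G"
    and "minor_minimal_non_splitting G"
  shows "\<nexists>v. cut_vertex G v"
proof
  assume "\<exists>v. cut_vertex G v"
  then obtain v where v: "cut_vertex G v" ..
  obtain S where S: "five_configuration G S" "\<not> config_splits G S"
    using assms(3) by (auto simp: minor_minimal_non_splitting_def non_splitting_def)
  have "verts G \<noteq> {}" using assms(2) by (simp add: connected_multigraph_def)
  then have "3 \<le> card (verts G)" using not_config_splits_card_verts[OF assms(1) S] by simp
  then obtain X A where sep: "separation G v X A" and ne: "A \<noteq> {}" "edges G - A \<noteq> {}"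
    using cut_vertex_separation[OF assms(1,2) v] by metis
  have "A \<subseteq> edges G" using sep by (simp add: separation_def)
  then have compl: "edges G - (edges G - A) = A" by blast
  from not_config_splits_one_side[OF assms(1) sep S]
  have "\<exists>e\<in>edges G. \<not> splits (delete_edge G e) \<or> \<not> splits (contract_edge G e)"
  proof
    assume "S \<subseteq> A"
    with ne(2) nonsplitting_minor[OF assms(1) sep S] show ?thesis by blast
  next
    \<comment> \<open>The sides of a separation are interchangeable, so the edge to delete or
      contract is now taken from \<open>A\<close>.\<close>
    assume "S \<subseteq> edges G - A"
    with ne(1) nonsplitting_minor[OF assms(1) separation_complement[OF assms(1) sep] S]
    show ?thesis unfolding compl using \<open>A \<subseteq> edges G\<close> by blast
  qed
  then show False using assms(3) by (auto simp: minor_minimal_non_splitting_def)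
qed

end
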